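(* For any graph $G$ on $n$ vertices, $\displaystyle \frac{n}{\operatorname{Z}(G)+1} \le \alpha(G)$.
   Context: All graphs are simple, finite and undirected. $\alpha(G)$ is the independence number of $G$. Zero forcing: given a set $B\subseteq V(G)$ of initially blue vertices (the rest white), if a blue vertex has exactly one white neighbor $w$, it can force $w$ to become blue; this rule is applied repeatedly. $B$ is a zero forcing set if all vertices can eventually become blue. $\operatorname{Z}(G)$ is the minimum cardinality of a zero forcing set of $G$. *)

theory Defs
  imports Complex_Main "Graph_Theory.Digraph"
begin

text \<open>
  Simple finite undirected graphs are the instances of the locale \<^locale>\<open>graph\<close>: finite,
  loop-free, symmetric digraphs without parallel arcs. An undirected edge between \<open>u\<close> and \<open>v\<close>
  is the pair of opposite arcs, so \<open>u \<rightarrow>\<^bsub>G\<^esub> v\<close> is adjacency.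
\<close>

definition independent_set :: "('a, 'b) pre_digraph \<Rightarrow> 'a set \<Rightarrow> bool" where
  "independent_set G S \<longleftrightarrow> S \<subseteq> verts G \<and> (\<forall>u\<in>S. \<forall>v\<in>S. \<not> u \<rightarrow>\<^bsub>G\<^esub> v)"

definition independence_number :: "('a, 'b) pre_digraph \<Rightarrow> nat" where
  "independence_number G = Max (card ` {S. independent_set G S})"

text \<open>One application of the colour change rule; the set arguments are the sets of blue vertices.\<close>

inductive force_step :: "('a, 'b) pre_digraph \<Rightarrow> 'a set \<Rightarrow> 'a set \<Rightarrow> bool" for G where
  force: "\<lbrakk>v \<in> B; {u \<in> verts G - B. v \<rightarrow>\<^bsub>G\<^esub> u} = {w}\<rbrakk> \<Longrightarrow> force_step G B (insert w B)"

definition zero_forcing_set :: "('a, 'b) pre_digraph \<Rightarrow> 'a set \<Rightarrow> bool" where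
  "zero_forcing_set G B \<longleftrightarrow> B \<subseteq> verts G \<and> (force_step G)\<^sup>*\<^sup>* B (verts G)"

definition zero_forcing_number :: "('a, 'b) pre_digraph \<Rightarrow> nat" where
  "zero_forcing_number G = Min (card ` {B. zero_forcing_set G B})"

end

theory Submission
  imports Defs
begin

text \<open>
  Every zero forcing set with \<open>k\<close> elements yields a proper colouring with \<open>k + 1\<close> colours, and
  the largest colour class is then an independent set with at least \<open>n / (k + 1)\<close> elements.

  For the colouring, call a blue vertex active as long as it has a white neighbour. At every
  time the active vertices lie in a set with at most \<open>k\<close> elements: when \<open>v\<close> forces \<open>w\<close>, the
  vertex \<open>v\<close> loses its last white neighbour, so \<open>w\<close> can take its place in that set. The blue
  neighbours of a vertex that is about to be forced are all active, as that vertex is still white.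
  Hence each forced vertex has at most \<open>k\<close> neighbours that became blue before it, and colouring
  the vertices greedily in the order in which they become blue needs no more than \<open>k + 1\<close>
  colours (lemma \<open>forcing_colouring\<close>).
\<close>

definition proper_colouring_on :: "('a, 'b) pre_digraph \<Rightarrow> 'a set \<Rightarrow> nat \<Rightarrow> ('a \<Rightarrow> nat) \<Rightarrow> bool" where
  "proper_colouring_on G B q c \<longleftrightarrow>
     c ` B \<subseteq> {..<q} \<and> (\<forall>x\<in>B. \<forall>y\<in>B. x \<rightarrow>\<^bsub>G\<^esub> y \<longrightarrow> c x \<noteq> c y)"

context graph
begin

text \<open>The greedy step: the neighbours of \<open>w\<close> in \<open>B\<close> use fewer than \<open>q\<close> colours, so one is left
  for \<open>w\<close>.\<close>

lemma proper_colouring_extend: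
  assumes c: "proper_colouring_on G B q c" and w: "w \<notin> B"
    and A: "finite A" "card A < q" "{x \<in> B. x \<rightarrow>\<^bsub>G\<^esub> w} \<subseteq> A"
  obtains c' where "proper_colouring_on G (insert w B) q c'"
proof -
  have "card (c ` A) < card {..<q}"
    using card_image_le[OF A(1), of c] A(2) by simp
  then have "\<not> {..<q} \<subseteq> c ` A"
    using A(1) card_mono[of "c ` A" "{..<q}"] by auto
  then obtain i where i: "i < q" "i \<notin> c ` A" by auto
  have fresh: "i \<noteq> c x" if "x \<in> B" "x \<rightarrow>\<^bsub>G\<^esub> w \<or> w \<rightarrow>\<^bsub>G\<^esub> x" for x
    using that i(2) A(3) arcs_ends_symmetric[OF sym_arcs] by blast
  have noloop: "\<not> w \<rightarrow>\<^bsub>G\<^esub> w"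
    using adj_not_same by blast
  have "proper_colouring_on G (insert w B) q (c(w := i))"
    using c w i(1) fresh noloop unfolding proper_colouring_on_def by auto
  then show thesis by (rule that)
qed

text \<open>The set \<open>A\<close> plays the role of the active vertices; only an upper bound on it is kept, which
  makes all of \<open>B\<^sub>0\<close> a valid choice at the start.\<close>

lemma forcing_colouring:
  assumes "(force_step G)\<^sup>*\<^sup>* B\<^sub>0 B" and "finite B\<^sub>0"
  shows "\<exists>A c. finite A \<and> card A \<le> card B\<^sub>0 \<and>
           {x \<in> B. \<exists>y \<in> verts G - B. x \<rightarrow>\<^bsub>G\<^esub> y} \<subseteq> A \<and>
           proper_colouring_on G B (card B\<^sub>0 + 1) c"
  using assms(1)
proof induction
  case base
  obtain c where "bij_betw c B\<^sub>0 {..<card B\<^sub>0}"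
    using ex_bij_betw_finite_nat[OF assms(2)] by (auto simp: atLeast0LessThan)
  then have "proper_colouring_on G B\<^sub>0 (card B\<^sub>0 + 1) c"
    unfolding proper_colouring_on_def bij_betw_def
    using adj_not_same by (auto simp: inj_on_eq_iff)
  then show ?case using assms(2) by blast
next
  case (step B B')
  from step.IH obtain A c where A: "finite A" "card A \<le> card B\<^sub>0"
    "{x \<in> B. \<exists>y \<in> verts G - B. x \<rightarrow>\<^bsub>G\<^esub> y} \<subseteq> A"
    and c: "proper_colouring_on G B (card B\<^sub>0 + 1) c" by blast
  from step.hyps(2) obtain v w where v: "v \<in> B"
    and white: "{u \<in> verts G - B. v \<rightarrow>\<^bsub>G\<^esub> u} = {w}" and B': "B' = insert w B"
    by (auto elim: force_step.cases)
  have w: "w \<in> verts G - B" "v \<rightarrow>\<^bsub>G\<^esub> w" using white by auto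
  have vA: "v \<in> A" using A(3) v w by blast
  have "{x \<in> B. x \<rightarrow>\<^bsub>G\<^esub> w} \<subseteq> A" using A(3) w(1) by blast
  then obtain c' where "proper_colouring_on G B' (card B\<^sub>0 + 1) c'"
    using proper_colouring_extend[OF c, of w A] A(1,2) w(1) unfolding B' by auto
  \<comment> \<open>\<open>w\<close> was the only white neighbour of \<open>v\<close>, so \<open>w\<close> can replace \<open>v\<close>.\<close>
  moreover let ?A = "insert w (A - {v})"
  have "card ?A \<le> card A"
    using card_insert_le_m1[of "card A" "A - {v}" w] A(1) vA
    by (auto simp: card_gt_0_iff)
  moreover have "{x \<in> B'. \<exists>y \<in> verts G - B'. x \<rightarrow>\<^bsub>G\<^esub> y} \<subseteq> ?A"
    using A(3) white unfolding B' by blast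
  ultimately show ?case using A(1,2) by (meson finite_Diff finite_insert order_trans)
qed

lemma card_le_independence_number:
  assumes "independent_set G S"
  shows "card S \<le> independence_number G"
proof -
  have "finite {S. independent_set G S}"
    by (rule finite_subset[of _ "Pow (verts G)"]) (auto simp: independent_set_def)
  then show ?thesis
    unfolding independence_number_def using assms by (intro Max_ge) auto
qed

lemma card_verts_le_colours_times_independence_number:
  assumes "proper_colouring_on G (verts G) q c"
  shows "card (verts G) \<le> q * independence_number G"
proof -
  have "card (verts G) = card (\<Union>i<q. {x \<in> verts G. c x = i})"
    using assms unfolding proper_colouring_on_def by (intro arg_cong[where f = card]) auto
  also have "\<dots> \<le> (\<Sum>i<q. card {x \<in> verts G. c x = i})"
    by (rule card_UN_le) simp
  also have "\<dots> \<le> (\<Sum>i<q. independence_number G)"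
  proof (intro sum_mono card_le_independence_number)
    fix i
    show "independent_set G {x \<in> verts G. c x = i}"
      using assms unfolding proper_colouring_on_def independent_set_def by fastforce
  qed
  finally show ?thesis by simp
qed

lemma zero_forcing_number_attained:
  obtains B where "zero_forcing_set G B" "card B = zero_forcing_number G"
proof -
  have "finite {B. zero_forcing_set G B}"
    by (rule finite_subset[of _ "Pow (verts G)"]) (auto simp: zero_forcing_set_def)
  moreover have "zero_forcing_set G (verts G)"
    by (simp add: zero_forcing_set_def)
  ultimately have "zero_forcing_number G \<in> card ` {B. zero_forcing_set G B}"
    unfolding zero_forcing_number_def by (intro Min_in) auto
  then show thesis using that by auto
qed

end

theorem corollary26:
  fixes G :: "('a, 'b) pre_digraph" and n :: nat
  assumes "graph G" and "card (verts G) = n"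
  shows "real n / (real (zero_forcing_number G) + 1) \<le> real (independence_number G)"
proof -
  interpret graph G by fact
  obtain B where B: "zero_forcing_set G B" "card B = zero_forcing_number G"
    by (rule zero_forcing_number_attained)
  then have "finite B" "(force_step G)\<^sup>*\<^sup>* B (verts G)"
    unfolding zero_forcing_set_def by (auto intro: finite_subset)
  then obtain c where "proper_colouring_on G (verts G) (card B + 1) c"
    using forcing_colouring by blast
  then have "n \<le> (zero_forcing_number G + 1) * independence_number G"
    using card_verts_le_colours_times_independence_number B(2) assms(2) by metis
  then have "real n \<le> real ((zero_forcing_number G + 1) * independence_number G)"
    by (rule of_nat_mono)
  then show ?thesis by (simp add: field_simps)
qed

end
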